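(* Fix the finite state space, the finite action spaces and the transition probabilities. Assume that for every transition payment $r\in\mathcal{R}$, the Shapley operator $T_r$ has an eigenvalue. Then the space $\mathcal{R}$ is covered by a polyhedral fan such that for each $r$ in the interior of a full-dimensional cone of this fan, $T_r$ has a unique eigenvector (up to an additive constant).
   Context: Data: $S=\{1,\dots,n\}$ is a finite state space; for each $i\in S$, $A_i$ is a nonempty finite set (actions of player MIN); for each $i\in S$, $a\in A_i$, $B_{i,a}$ is a nonempty finite set (actions of player MAX); for each $i\in S$, $a\in A_i$, $b\in B_{i,a}$, $P_i^{ab}$ is a probability over $S$, seen as a row vector, so that $P_i^{ab}x=\sum_{j=1}^n (P_i^{ab})_jx_j$ for $x\in\mathbb{R}^n$. The space of transition payments $\mathcal{R}$ is the set of all real families $r=(r_i^{ab})$ indexed by the triples $(i,a,b)$ with $i\in S$, $a\in A_i$, $b\in B_{i,a}$; it is identified with $\mathbb{R}^q$, where $q$ is the number of such triples. For $r\in\mathcal{R}$, the Shapley operator $T_r:\mathbb{R}^n\to\mathbb{R}^n$ is $$[T_r(x)]_i=\min_{a\in A_i}\max_{b\in B_{i,a}}\big(r_i^{ab}+P_i^{ab}x\big),\qquad i\in S.$$ Let $\mathbf{1}=(1,\dots,1)\in\mathbb{R}^n$. A map $T:\mathbb{R}^n\to\mathbb{R}^n$ has an eigenvalue $\lambda\in\mathbb{R}$ if there is $u\in\mathbb{R}^n$ such that $T(u)=\lambda\mathbf{1}+u$; such a vector $u$ is called an eigenvector (or bias vector) of $T$. $T_r$ has a unique eigenvector (up to an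 additive constant) if its set of eigenvectors is of the form $\{u+t\mathbf{1}\mid t\in\mathbb{R}\}$ for some $u\in\mathbb{R}^n$. A polyhedral fan in $\mathbb{R}^q$ is a finite set $\mathcal{K}$ of polyhedral cones such that every face of an element of $\mathcal{K}$ belongs to $\mathcal{K}$, and for all $P,Q\in\mathcal{K}$, $P\cap Q$ is a face of both $P$ and $Q$. It covers $\mathbb{R}^q$ if the union of its cones is $\mathbb{R}^q$. *)

theory Defs
  imports "HOL-Analysis.Analysis"
begin

text \<open>The state space is the finite type \<^typ>\<open>'n\<close>, so a vector indexed by the states is an element
  of \<open>real ^ 'n\<close>. Only the values of \<open>B\<close>, \<open>P\<close> and \<open>idx\<close> at admissible triples matter.\<close>

definition action_triples :: "('n \<Rightarrow> 'a set) \<Rightarrow> ('n \<Rightarrow> 'a \<Rightarrow> 'b set) \<Rightarrow> ('n \<times> 'a \<times> 'b) set" where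
  "action_triples A B = {(i, a, b). a \<in> A i \<and> b \<in> B i a}"

definition probability_vector :: "real ^ 'n \<Rightarrow> bool" where
  "probability_vector p \<longleftrightarrow> (\<forall>j. 0 \<le> p $ j) \<and> (\<Sum>j\<in>UNIV. p $ j) = 1"

text \<open>The space of transition payments is identified with \<open>real ^ 'q\<close> by an enumeration \<open>idx\<close>,
  a bijection from \<open>action_triples A B\<close> onto the finite type \<^typ>\<open>'q\<close>: the payment of the triple
  \<open>(i, a, b)\<close> is the coordinate \<open>r $ idx (i, a, b)\<close>.\<close>

definition shapley ::
  "('n::finite \<Rightarrow> 'a set) \<Rightarrow> ('n \<Rightarrow> 'a \<Rightarrow> 'b set) \<Rightarrow> ('n \<Rightarrow> 'a \<Rightarrow> 'b \<Rightarrow> real ^ 'n) \<Rightarrow>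
    ('n \<times> 'a \<times> 'b \<Rightarrow> 'q::finite) \<Rightarrow> real ^ 'q \<Rightarrow> real ^ 'n \<Rightarrow> real ^ 'n" where
  "shapley A B P idx r x =
    (\<chi> i. MIN a\<in>A i. MAX b\<in>B i a. r $ idx (i, a, b) + (\<Sum>j\<in>UNIV. P i a b $ j * x $ j))"

text \<open>In \<open>real ^ 'n\<close> the constant \<open>1\<close> is the vector all of whose entries are 1.\<close>

definition has_eigenvalue :: "(real ^ 'n \<Rightarrow> real ^ 'n) \<Rightarrow> real \<Rightarrow> bool" where
  "has_eigenvalue T l \<longleftrightarrow> (\<exists>u. T u = l *\<^sub>R 1 + u)"

definition eigenvectors :: "(real ^ 'n \<Rightarrow> real ^ 'n) \<Rightarrow> (real ^ 'n) set" where
  "eigenvectors T = {u. \<exists>l. T u = l *\<^sub>R 1 + u}"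

definition unique_eigenvector :: "(real ^ 'n \<Rightarrow> real ^ 'n) \<Rightarrow> bool" where
  "unique_eigenvector T \<longleftrightarrow> (\<exists>u. eigenvectors T = {u + t *\<^sub>R 1 | t. True})"

definition polyhedral_cone :: "'v::euclidean_space set \<Rightarrow> bool" where
  "polyhedral_cone C \<longleftrightarrow> polyhedron C \<and> convex_cone C"

text \<open>The library counts the empty set as a face of every set. Cones are nonempty here, so only
  nonempty faces are required to belong to the fan.\<close>

definition polyhedral_fan :: "'v::euclidean_space set set \<Rightarrow> bool" where
  "polyhedral_fan K \<longleftrightarrow>
    finite K \<and>
    (\<forall>C\<in>K. polyhedral_cone C) \<and>
    (\<forall>C\<in>K. \<forall>F. F face_of C \<and> F \<noteq> {} \<longrightarrow> F \<in> K) \<and>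
    (\<forall>C\<in>K. \<forall>D\<in>K. C \<inter> D face_of C \<and> C \<inter> D face_of D)"

definition full_dimensional :: "'v::euclidean_space set \<Rightarrow> bool" where
  "full_dimensional C \<longleftrightarrow> aff_dim C = int DIM('v)"

end

theory Submission
  imports Defs
begin

text \<open>An eigenvector \<open>u\<close> of \<open>T\<^sub>r\<close> satisfies the linear system \<open>r\<^sub>f + M\<^sub>f u = \<lambda>1 + u\<close> of a pair \<open>f\<close> of
  optimal policies. For each of the finitely many \<open>f\<close>, either this system has at most one solution up
  to constants, or it is solvable only for \<open>r\<close> in some hyperplane; the fan is that of the
  arrangement of these hyperplanes. Off the hyperplanes, \<open>T\<^sub>r\<close> thus has only finitely many
  eigenvectors up to constants. If two of them were not equal up to constants, there would be
  infinitely many: normalised so that \<open>min (v - u) = 0\<close> and \<open>d = max (v - u)\<close>, Brouwer's theorem yields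
  for every \<open>s\<close> in \<open>[0, d]\<close> an eigenvector in the box
  \<open>{x. u \<le> x \<le> v, v - (d - s) \<le> x \<le> u + s}\<close>, which \<open>T\<^sub>r - \<lambda>\<close> preserves.\<close>

section \<open>The fan of a central hyperplane arrangement\<close>

text \<open>The closed cell of \<open>x\<close> in the arrangement of the hyperplanes orthogonal to
  the members of \<open>H\<close>. Indexing cells by points instead of sign vectors leaves out the
  sign patterns that no point realises.\<close>

definition sign_cone :: "'v::euclidean_space set \<Rightarrow> 'v \<Rightarrow> 'v set" where
  "sign_cone H x = {y. \<forall>c\<in>H. (c \<bullet> x = 0 \<longrightarrow> c \<bullet> y = 0) \<and> (c \<bullet> x > 0 \<longrightarrow> c \<bullet> y \<ge> 0) \<and>
    (c \<bullet> x < 0 \<longrightarrow> c \<bullet> y \<le> 0)}"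

lemma mem_sign_cone_self: "x \<in> sign_cone H x"
  by (simp add: sign_cone_def)

lemma polyhedral_cone_sign_cone:
  assumes "finite H"
  shows "polyhedral_cone (sign_cone H x)"
proof -
  let ?h = "\<lambda>c. {y. (c \<bullet> x = 0 \<longrightarrow> c \<bullet> y = 0) \<and> (c \<bullet> x > 0 \<longrightarrow> c \<bullet> y \<ge> 0) \<and> (c \<bullet> x < 0 \<longrightarrow> c \<bullet> y \<le> 0)}"
  have h: "polyhedron (?h c) \<and> convex_cone (?h c)" for c
  proof (cases "c \<bullet> x" "0::real" rule: linorder_cases)
    case less
    then show ?thesis by (simp add: polyhedron_halfspace_le convex_cone_halfspace_le)
  next
    case equal
    then show ?thesis by (simp add: polyhedron_hyperplane convex_cone_iff inner_add_right)
  next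
    case greater
    then show ?thesis by (simp add: polyhedron_halfspace_ge convex_cone_halfspace_ge)
  qed
  have "polyhedron (\<Inter>(?h ` H))"
    using assms h by (intro polyhedron_Inter) auto
  moreover have "convex_cone (\<Inter>(?h ` H))"
    using h by (intro convex_cone_Inter) auto
  moreover have "sign_cone H x = \<Inter>(?h ` H)"
    by (auto simp: sign_cone_def)
  ultimately show ?thesis
    by (simp add: polyhedral_cone_def)
qed

lemma convex_sign_cone:
  assumes "finite H"
  shows "convex (sign_cone H x)"
  using polyhedral_cone_sign_cone[OF assms] by (simp add: polyhedral_cone_def polyhedron_imp_convex)

text \<open>The cone depends on \<open>x\<close> only through the signs of the products
  \<open>c \<bullet> x\<close>.\<close>

lemma finite_range_sign_cone:
  assumes "finite H"
  shows "finite (range (sign_cone H))"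
proof -
  \<comment> \<open>\<open>restrict\<close> fixes the value outside \<open>H\<close>, so that the
    sign vectors lie in a finite \<open>PiE\<close>.\<close>
  let ?s = "\<lambda>x. restrict (\<lambda>c. sgn (c \<bullet> x)) H"
  let ?g = "\<lambda>s. {y. \<forall>c\<in>H. (s c = 0 \<longrightarrow> c \<bullet> y = 0) \<and> (s c > 0 \<longrightarrow> c \<bullet> y \<ge> 0) \<and> (s c < 0 \<longrightarrow> c \<bullet> y \<le> 0)}"
  have "sign_cone H x = ?g (?s x)" for x
    by (auto simp: sign_cone_def sgn_zero_iff)
  then have "range (sign_cone H) = ?g ` range ?s"
    by (simp add: image_image)
  moreover have "range ?s \<subseteq> H \<rightarrow>\<^sub>E {-1, 0, 1}"
    by (auto simp: sgn_real_def split: if_splits)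
  then have "finite (range ?s)"
    by (rule finite_subset) (simp add: assms finite_PiE)
  ultimately show ?thesis by simp
qed

text \<open>On the cone of \<open>x\<close>, each \<open>c\<close> in \<open>H\<close> keeps one
  weak sign. If the cone of \<open>y\<close> demands the opposite weak sign at a point inside a
  segment, then \<open>c\<close> must vanish at both ends, so the ends meet that demand too.\<close>

lemma sign_cone_Int_face_of:
  assumes "finite H"
  shows "sign_cone H x \<inter> sign_cone H y face_of sign_cone H x"
  unfolding face_of_def
proof (intro conjI ballI impI)
  show "convex (sign_cone H x \<inter> sign_cone H y)"
    by (intro convex_Int convex_sign_cone assms)
  fix p q m
  assume p: "p \<in> sign_cone H x" and q: "q \<in> sign_cone H x"
    and m: "m \<in> sign_cone H x \<inter> sign_cone H y" "m \<in> open_segment p q"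
  obtain t where t: "0 < t" "t < 1" "m = (1 - t) *\<^sub>R p + t *\<^sub>R q"
    using m(2) by (auto simp: in_segment)
  have "(c \<bullet> y = 0 \<longrightarrow> c \<bullet> p = 0 \<and> c \<bullet> q = 0) \<and> (c \<bullet> y > 0 \<longrightarrow> c \<bullet> p \<ge> 0 \<and> c \<bullet> q \<ge> 0)
      \<and> (c \<bullet> y < 0 \<longrightarrow> c \<bullet> p \<le> 0 \<and> c \<bullet> q \<le> 0)" if c: "c \<in> H" for c
  proof -
    have cm: "c \<bullet> m = (1 - t) * (c \<bullet> p) + t * (c \<bullet> q)"
      by (simp add: t inner_add_right)
    show ?thesis
    proof (cases "c \<bullet> x" "0::real" rule: linorder_cases)
      case less
      then have np: "c \<bullet> p \<le> 0" "c \<bullet> q \<le> 0" using p q c by (auto simp: sign_cone_def)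
      then have "(1 - t) * (c \<bullet> p) \<le> 0" "t * (c \<bullet> q) \<le> 0"
        using t by (auto simp: mult_le_0_iff)
      then have "c \<bullet> p = 0 \<and> c \<bullet> q = 0" if "c \<bullet> m \<ge> 0"
        using that t cm by (smt (verit) mult_eq_0_iff)
      then show ?thesis using np m(1) c by (auto simp: sign_cone_def)
    next
      case equal
      then show ?thesis using p q c by (auto simp: sign_cone_def)
    next
      case greater
      then have np: "c \<bullet> p \<ge> 0" "c \<bullet> q \<ge> 0" using p q c by (auto simp: sign_cone_def)
      then have "(1 - t) * (c \<bullet> p) \<ge> 0" "t * (c \<bullet> q) \<ge> 0"
        using t by auto
      then have "c \<bullet> p = 0 \<and> c \<bullet> q = 0" if "c \<bullet> m \<le> 0"
        using that t cm by (smt (verit) mult_eq_0_iff)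
      then show ?thesis using np m(1) c by (auto simp: sign_cone_def)
    qed
  qed
  then show "p \<in> sign_cone H x \<inter> sign_cone H y" "q \<in> sign_cone H x \<inter> sign_cone H y"
    using p q by (auto simp: sign_cone_def)
qed auto

lemma sign_cone_mono:
  assumes "y \<in> sign_cone H x"
  shows "sign_cone H y \<subseteq> sign_cone H x"
proof
  fix z assume z: "z \<in> sign_cone H y"
  have "(c \<bullet> x = 0 \<longrightarrow> c \<bullet> z = 0) \<and> (c \<bullet> x > 0 \<longrightarrow> c \<bullet> z \<ge> 0) \<and> (c \<bullet> x < 0 \<longrightarrow> c \<bullet> z \<le> 0)"
    if "c \<in> H" for c
    using assms z that unfolding sign_cone_def mem_Collect_eq
    by (smt (verit))
  then show "z \<in> sign_cone H x" by (simp add: sign_cone_def)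
qed

text \<open>By the prolongation criterion: every segment from a point \<open>z\<close> of the cone
  to \<open>y\<close> can be extended slightly beyond \<open>y\<close>. Strict signs at
  \<open>y\<close> persist by continuity, and a \<open>c\<close> vanishing at \<open>y\<close> also
  vanishes at \<open>z\<close>, hence on the whole line.\<close>

lemma mem_rel_interior_sign_cone:
  assumes "finite H"
  shows "y \<in> rel_interior (sign_cone H y)"
proof -
  have "\<exists>e>1. (1 - e) *\<^sub>R z + e *\<^sub>R y \<in> sign_cone H y" if z: "z \<in> sign_cone H y" for z
  proof -
    have ev: "\<forall>\<^sub>F e in at_right 1. (c \<bullet> y > 0 \<longrightarrow> c \<bullet> ((1 - e) *\<^sub>R z + e *\<^sub>R y) \<ge> 0) \<and>
        (c \<bullet> y < 0 \<longrightarrow> c \<bullet> ((1 - e) *\<^sub>R z + e *\<^sub>R y) \<le> 0)" for c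
    proof -
      have lim: "((\<lambda>e. c \<bullet> ((1 - e) *\<^sub>R z + e *\<^sub>R y)) \<longlongrightarrow> c \<bullet> ((1 - 1) *\<^sub>R z + 1 *\<^sub>R y)) (at_right 1)"
        by (intro tendsto_intros)
      show ?thesis
      proof (cases "c \<bullet> y" "0::real" rule: linorder_cases)
        case less
        then have "\<forall>\<^sub>F e in at_right 1. c \<bullet> ((1 - e) *\<^sub>R z + e *\<^sub>R y) < 0"
          using lim by (intro order_tendstoD(2)) auto
        then show ?thesis by eventually_elim (use less in auto)
      next
        case greater
        then have "\<forall>\<^sub>F e in at_right 1. c \<bullet> ((1 - e) *\<^sub>R z + e *\<^sub>R y) > 0"
          using lim by (intro order_tendstoD(1)) auto
        then show ?thesis by eventually_elim (use greater in auto)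
      qed simp
    qed
    have "\<forall>\<^sub>F e in at_right 1. \<forall>c\<in>H. (c \<bullet> y > 0 \<longrightarrow> c \<bullet> ((1 - e) *\<^sub>R z + e *\<^sub>R y) \<ge> 0) \<and>
        (c \<bullet> y < 0 \<longrightarrow> c \<bullet> ((1 - e) *\<^sub>R z + e *\<^sub>R y) \<le> 0)"
      using ev assms by (intro eventually_ball_finite) auto
    then have "\<forall>\<^sub>F e::real in at_right 1. 1 < e \<and> (1 - e) *\<^sub>R z + e *\<^sub>R y \<in> sign_cone H y"
      using eventually_at_right_less[of 1]
    proof eventually_elim
      case (elim e)
      have "c \<bullet> ((1 - e) *\<^sub>R z + e *\<^sub>R y) = 0" if "c \<in> H" "c \<bullet> y = 0" for c
        using z that by (simp add: sign_cone_def inner_add_right)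
      with elim show ?case by (simp add: sign_cone_def)
    qed
    then show ?thesis
      using eventually_happens'[OF trivial_limit_at_right_real] by blast
  qed
  then show ?thesis
    using convex_rel_interior_iff[OF convex_sign_cone[OF assms], of y y] mem_sign_cone_self[of y H] by blast
qed

text \<open>For \<open>y\<close> in the relative interior of \<open>F\<close>, the cell of
  \<open>y\<close> is also a face with \<open>y\<close> in its relative interior, and two faces
  whose relative interiors meet are equal.\<close>

lemma face_of_sign_cone:
  assumes "finite H" "F face_of sign_cone H x" "F \<noteq> {}"
  shows "F \<in> range (sign_cone H)"
proof -
  have "convex F" using assms(2) by (rule face_of_imp_convex)
  then obtain y where y: "y \<in> rel_interior F"
    using assms(3) rel_interior_eq_empty by blast
  then have "y \<in> sign_cone H x"
    using face_of_imp_subset[OF assms(2)] rel_interior_subset by blast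
  then have "sign_cone H y face_of sign_cone H x"
    using sign_cone_Int_face_of[OF assms(1), of x y] sign_cone_mono by (metis Int_absorb1)
  then have "F = sign_cone H y"
    using face_of_eq[OF assms(2)] y mem_rel_interior_sign_cone[OF assms(1)] by blast
  then show ?thesis by blast
qed

lemma polyhedral_fan_sign_cones:
  assumes "finite H"
  shows "polyhedral_fan (range (sign_cone H))"
  unfolding polyhedral_fan_def
proof (intro conjI ballI allI impI)
  show "finite (range (sign_cone H))" by (rule finite_range_sign_cone[OF assms])
  fix C assume "C \<in> range (sign_cone H)"
  then obtain x where C: "C = sign_cone H x" by blast
  show "polyhedral_cone C" unfolding C by (rule polyhedral_cone_sign_cone[OF assms])
  show "F \<in> range (sign_cone H)" if "F face_of C \<and> F \<noteq> {}" for F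
    using face_of_sign_cone[OF assms] that unfolding C by blast
  fix D assume "D \<in> range (sign_cone H)"
  then obtain y where D: "D = sign_cone H y" by blast
  show "C \<inter> D face_of C" "C \<inter> D face_of D"
    unfolding C D using sign_cone_Int_face_of[OF assms] by (metis Int_commute)+
qed

text \<open>If \<open>c\<close> vanished at \<open>r\<close>, small moves along \<open>c\<close> and
  \<open>-c\<close> would stay in the cone and give \<open>c\<close> both strict signs
  there.\<close>

lemma inner_neq_0_interior_sign_cone:
  assumes "r \<in> interior (sign_cone H x)" "c \<in> H" "c \<noteq> 0"
  shows "c \<bullet> r \<noteq> 0"
proof
  assume 0: "c \<bullet> r = 0"
  obtain e where e: "e > 0" "ball r e \<subseteq> sign_cone H x"
    using assms(1) by (auto simp: mem_interior)
  define d where "d = e / 2 / norm c"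
  have d: "d > 0" using e assms(3) by (simp add: d_def)
  have "norm (d *\<^sub>R c) < e"
    using e assms(3) by (simp add: d_def)
  then have "r + d *\<^sub>R c \<in> sign_cone H x" "r - d *\<^sub>R c \<in> sign_cone H x"
    using e(2) by (auto simp: dist_norm)
  moreover have "c \<bullet> (r + d *\<^sub>R c) > 0" "c \<bullet> (r - d *\<^sub>R c) < 0"
    using 0 d assms(3) by (auto simp: inner_add_right inner_diff_right)
  ultimately show False
    using assms(2) unfolding sign_cone_def mem_Collect_eq by (smt (verit))
qed

section \<open>Topical maps and their eigenvectors\<close>

text \<open>Equivalent to \<open>T\<close> being monotone and commuting with the addition of constants.\<close>

definition topical :: "(real ^ 'n \<Rightarrow> real ^ 'n) \<Rightarrow> bool" where
  "topical T \<longleftrightarrow> (\<forall>x y c. (\<forall>i. x $ i \<le> y $ i + c) \<longrightarrow> (\<forall>i. T x $ i \<le> T y $ i + c))"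

lemma topicalD:
  assumes "topical T" "\<And>i. x $ i \<le> y $ i + c"
  shows "T x $ i \<le> T y $ i + c"
  using assms unfolding topical_def by blast

text \<open>The Euclidean distance bounds every coordinate difference, so each coordinate of
  \<open>T\<close> is 1-Lipschitz.\<close>

lemma topical_continuous_on:
  fixes T :: "real ^ 'n \<Rightarrow> real ^ 'n"
  assumes "topical T"
  shows "continuous_on S T"
proof -
  have le: "T x $ i \<le> T y $ i + dist x y" for x y i
  proof (rule topicalD[OF assms])
    fix j
    have "\<bar>(x - y) $ j\<bar> \<le> dist x y"
      unfolding dist_norm by (rule component_le_norm_cart)
    then show "x $ j \<le> y $ j + dist x y" by simp
  qed
  have "continuous_on S (\<lambda>x. T x $ i)" for i
  proof -
    have "dist (T x $ i) (T y $ i) \<le> dist x y" for x y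
      using le[of x i y] le[of y i x] by (simp add: dist_real_def dist_commute abs_le_iff)
    then show ?thesis
      unfolding continuous_on_iff by (meson le_less_trans)
  qed
  then have "continuous_on S (\<lambda>x. \<chi> i. T x $ i)"
    by (rule continuous_on_vec_lambda)
  then show ?thesis by simp
qed

lemma finite_type_maximizer:
  fixes f :: "'n::finite \<Rightarrow> real"
  obtains k where "\<And>i. f i \<le> f k"
proof -
  have "Max (range f) \<in> range f" by (intro Max_in) auto
  then obtain k where "Max (range f) = f k" by blast
  moreover have "f i \<le> Max (range f)" for i by (intro Max_ge) auto
  ultimately show ?thesis using that by metis
qed

text \<open>Shifting \<open>u\<close> up until it dominates \<open>v\<close> with contact at
  \<open>k\<close>, and then comparing the images at \<open>k\<close>, compares the eigenvalues.
  Exchanging \<open>u\<close> and \<open>v\<close> shows that the eigenvalue is unique.\<close>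

lemma topical_eigenvalue_le:
  fixes T :: "real ^ 'n \<Rightarrow> real ^ 'n"
  assumes "topical T" "T u = l *\<^sub>R 1 + u" "T v = m *\<^sub>R 1 + v"
  shows "m \<le> l"
proof -
  obtain k where k: "\<And>i. v $ i - u $ i \<le> v $ k - u $ k"
    using finite_type_maximizer[of "\<lambda>i. v $ i - u $ i"] by metis
  have "T v $ k \<le> T u $ k + (v $ k - u $ k)"
    using k by (intro topicalD[OF assms(1)]) (simp add: algebra_simps)
  then show ?thesis by (simp add: assms)
qed

text \<open>Each of the four bounds compares \<open>w\<close> with a shifted eigenvector, so the box
  is preserved. The bounds force \<open>w = u\<close> at coordinates where \<open>v = u\<close>, and
  \<open>w = u + s\<close> where \<open>v = u + d\<close>, which tells apart the eigenvectors for
  different \<open>s\<close>.\<close>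

lemma topical_intermediate_eigenvector:
  fixes T :: "real ^ 'n \<Rightarrow> real ^ 'n"
  assumes T: "topical T" and u: "T u = l *\<^sub>R 1 + u" and v: "T v = l *\<^sub>R 1 + v"
    and uv: "\<And>i. u $ i \<le> v $ i" "\<And>i. v $ i \<le> u $ i + d" and s: "0 \<le> s" "s \<le> d"
  shows "\<exists>w. T w = l *\<^sub>R 1 + w \<and> (\<forall>i. u $ i \<le> w $ i \<and> w $ i \<le> v $ i \<and>
    w $ i \<le> u $ i + s \<and> v $ i - (d - s) \<le> w $ i)"
proof -
  define X where "X = cbox (\<chi> i. max (u $ i) (v $ i - (d - s))) (\<chi> i. min (v $ i) (u $ i + s))"
  have X: "x \<in> X \<longleftrightarrow> (\<forall>i. u $ i \<le> x $ i \<and> x $ i \<le> v $ i \<and>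
    x $ i \<le> u $ i + s \<and> v $ i - (d - s) \<le> x $ i)" for x
    by (auto simp: X_def mem_box_cart)
  \<comment> \<open>The lower corner obeys the upper bounds; the critical one,
    \<open>v - (d - s)\<close> against \<open>u + s\<close>, is
    \<open>v \<le> u + d\<close>.\<close>
  have "(\<chi> i. max (u $ i) (v $ i - (d - s))) \<in> X"
    unfolding X
  proof
    fix i
    show "u $ i \<le> (\<chi> i. max (u $ i) (v $ i - (d - s))) $ i \<and>
        (\<chi> i. max (u $ i) (v $ i - (d - s))) $ i \<le> v $ i \<and>
        (\<chi> i. max (u $ i) (v $ i - (d - s))) $ i \<le> u $ i + s \<and>
        v $ i - (d - s) \<le> (\<chi> i. max (u $ i) (v $ i - (d - s))) $ i"
      using uv[of i] s by simp
  qed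
  then have ne: "X \<noteq> {}" by blast
  have cont: "continuous_on X (\<lambda>x. T x - l *\<^sub>R 1)"
    by (intro continuous_intros topical_continuous_on T)
  have "T x - l *\<^sub>R 1 \<in> X" if "x \<in> X" for x
    unfolding X
  proof
    fix i
    note x = that[unfolded X, rule_format]
    have "T u $ i \<le> T x $ i + 0" "T x $ i \<le> T v $ i + 0" "T x $ i \<le> T u $ i + s"
      "T v $ i \<le> T x $ i + (d - s)"
      by (intro topicalD[OF T]; use x in \<open>simp add: algebra_simps\<close>)+
    then show "u $ i \<le> (T x - l *\<^sub>R 1) $ i \<and> (T x - l *\<^sub>R 1) $ i \<le> v $ i \<and>
        (T x - l *\<^sub>R 1) $ i \<le> u $ i + s \<and> v $ i - (d - s) \<le> (T x - l *\<^sub>R 1) $ i"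
      by (simp add: u v)
  qed
  then obtain w where "w \<in> X" "T w - l *\<^sub>R 1 = w"
    using brouwer[OF _ _ ne cont] by (auto simp: X_def compact_cbox convex_box)
  then have "T w = l *\<^sub>R 1 + w" by (simp add: algebra_simps)
  with \<open>w \<in> X\<close> show ?thesis unfolding X by blast
qed

text \<open>The map \<open>p\<close> labels eigenvectors by a finite type; in the application the
  label is a pair of optimal policies.\<close>

lemma unique_eigenvector_if_finitely_many:
  fixes T :: "real ^ 'n \<Rightarrow> real ^ 'n" and p :: "real ^ 'n \<Rightarrow> 'f::finite"
  assumes T: "topical T" and ex: "has_eigenvalue T l"
    and p: "\<And>u v. u \<in> eigenvectors T \<Longrightarrow> v \<in> eigenvectors T \<Longrightarrow> p u = p v \<Longrightarrow> \<exists>t. v = u + t *\<^sub>R 1"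
  shows "unique_eigenvector T"
proof -
  obtain u where u: "T u = l *\<^sub>R 1 + u"
    using ex unfolding has_eigenvalue_def by blast
  have shift: "T (w + t *\<^sub>R 1) = T w + t *\<^sub>R 1" for w t
  proof -
    have "T (w + t *\<^sub>R 1) $ i = T w $ i + t" for i
    proof -
      have "T (w + t *\<^sub>R 1) $ i \<le> T w $ i + t" "T w $ i \<le> T (w + t *\<^sub>R 1) $ i + (- t)"
        by (intro topicalD[OF T]; simp)+
      then show ?thesis by simp
    qed
    then show ?thesis by (simp add: vec_eq_iff)
  qed
  have "\<exists>t. v = u + t *\<^sub>R 1" if v: "T v = m *\<^sub>R 1 + v" for v m
  proof -
    have "m = l"
      using topical_eigenvalue_le[OF T u v] topical_eigenvalue_le[OF T v u] by simp
    obtain j where j: "\<And>i. v $ i - u $ i \<le> v $ j - u $ j"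
      using finite_type_maximizer[of "\<lambda>i. v $ i - u $ i"] by metis
    obtain k where "\<And>i. u $ i - v $ i \<le> u $ k - v $ k"
      using finite_type_maximizer[of "\<lambda>i. u $ i - v $ i"] by metis
    then have k: "v $ k - u $ k \<le> v $ i - u $ i" for i
      by (smt (verit))
    \<comment> \<open>Thus \<open>u + b\<close> touches \<open>v\<close> from below at
      \<open>k\<close>, and \<open>u + b + d\<close> touches \<open>v\<close> from above at
      \<open>j\<close>.\<close>
    define b where "b = v $ k - u $ k"
    define d where "d = v $ j - u $ j - b"
    have Tub: "T (u + b *\<^sub>R 1) = l *\<^sub>R 1 + (u + b *\<^sub>R 1)"
      by (simp add: shift u)
    have "\<exists>w. T w = l *\<^sub>R 1 + w \<and> w $ k = v $ k \<and> w $ j = u $ j + b + s" if s: "s \<in> {0..d}" for s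
    proof -
      have "\<exists>w. T w = l *\<^sub>R 1 + w \<and> (\<forall>i. (u + b *\<^sub>R 1) $ i \<le> w $ i \<and> w $ i \<le> v $ i \<and>
          w $ i \<le> (u + b *\<^sub>R 1) $ i + s \<and> v $ i - (d - s) \<le> w $ i)"
      proof (rule topical_intermediate_eigenvector[OF T Tub])
        show "T v = l *\<^sub>R 1 + v" using v \<open>m = l\<close> by simp
        show "(u + b *\<^sub>R 1) $ i \<le> v $ i" "v $ i \<le> (u + b *\<^sub>R 1) $ i + d" for i
          using j[of i] k[of i] by (auto simp: b_def d_def)
      qed (use s in auto)
      then obtain w where w: "T w = l *\<^sub>R 1 + w" "\<And>i. (u + b *\<^sub>R 1) $ i \<le> w $ i \<and> w $ i \<le> v $ i \<and>
          w $ i \<le> (u + b *\<^sub>R 1) $ i + s \<and> v $ i - (d - s) \<le> w $ i" by blast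
      have "w $ k = v $ k" "w $ j = u $ j + b + s"
        using w(2)[of k] w(2)[of j] by (auto simp: b_def d_def)
      with w(1) show ?thesis by blast
    qed
    then obtain w where w: "\<And>s. s \<in> {0..d} \<Longrightarrow> T (w s) = l *\<^sub>R 1 + w s \<and> w s $ k = v $ k \<and>
        w s $ j = u $ j + b + s"
      by metis
    \<comment> \<open>All \<open>w s\<close> agree at \<open>k\<close>, so equal labels leave no
      constant to add; the coordinate \<open>j\<close> then recovers \<open>s\<close>. An interval
      with \<open>d > 0\<close> would thus inject into a finite type.\<close>
    have "inj_on (\<lambda>s. p (w s)) {0..d}"
    proof (rule inj_onI)
      fix s s' assume s: "s \<in> {0..d}" "s' \<in> {0..d}" "p (w s) = p (w s')"
      then have "w s \<in> eigenvectors T" "w s' \<in> eigenvectors T"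
        using w unfolding eigenvectors_def by blast+
      then obtain t where t: "w s' = w s + t *\<^sub>R 1"
        using p s(3) by blast
      have "t = 0" using arg_cong[OF t, of "\<lambda>x. x $ k"] w s by simp
      then show "s = s'" using arg_cong[OF t, of "\<lambda>x. x $ j"] w s by simp
    qed
    then have "finite {0..d}"
      by (rule inj_on_finite[where B = UNIV]) auto
    then have "d \<le> 0"
      using infinite_Icc[of 0 d] by force
    then have "v $ i = u $ i + b" for i
      using j[of i] k[of i] by (simp add: b_def d_def)
    then show ?thesis by (auto simp: vec_eq_iff)
  qed
  moreover have "u + t *\<^sub>R 1 \<in> eigenvectors T" for t
    unfolding eigenvectors_def using shift[of u t] u by (auto simp: add.assoc)
  ultimately have "eigenvectors T = {u + t *\<^sub>R 1 | t. True}"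
    unfolding eigenvectors_def by blast
  then show ?thesis unfolding unique_eigenvector_def by blast
qed

section \<open>Uniqueness of the bias for a fixed pair of policies\<close>

text \<open>A solution \<open>u\<close>, shifted so that \<open>u $ k = l\<close>, is a preimage of the payment vector under the
  linear endomorphism \<open>L u = u - M u + (u $ k) 1\<close>, where the rows of \<open>M\<close> are the \<open>Q (f i)\<close>.
  Either \<open>L\<close> is bijective, or its range lies in a hyperplane.\<close>

lemma policy_bias_generically_unique:
  fixes Q :: "'q::finite \<Rightarrow> real ^ 'n" and f :: "'n \<Rightarrow> 'q"
  assumes "inj f" and Q: "\<And>q. (\<Sum>j\<in>UNIV. Q q $ j) = 1"
  shows "\<exists>c::real ^ 'q. c \<noteq> 0 \<and> (\<forall>r u v l m. c \<bullet> r \<noteq> 0 \<longrightarrow>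
    (\<forall>i. r $ f i + (\<Sum>j\<in>UNIV. Q (f i) $ j * u $ j) = l + u $ i) \<longrightarrow>
    (\<forall>i. r $ f i + (\<Sum>j\<in>UNIV. Q (f i) $ j * v $ j) = m + v $ i) \<longrightarrow> (\<exists>t. v = u + t *\<^sub>R 1))"
proof -
  \<comment> \<open>An arbitrary state, used for normalisation.\<close>
  obtain k :: 'n where True by simp
  define L :: "real ^ 'n \<Rightarrow> real ^ 'n" where
    "L u = (\<chi> i. u $ i - (\<Sum>j\<in>UNIV. Q (f i) $ j * u $ j) + u $ k)" for u
  have lin: "linear L"
    by (rule linearI)
      (simp_all add: L_def vec_eq_iff algebra_simps sum.distrib sum_distrib_left)
  \<comment> \<open>After the shift, coordinate \<open>k\<close> equals \<open>l\<close>, so the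
    last term of \<open>L\<close> stands for the eigenvalue. The rest of \<open>L\<close> ignores
    the shift because the rows of \<open>Q\<close> sum to 1.\<close>
  have L: "L (u + (l - u $ k) *\<^sub>R 1) = (\<chi> i. r $ f i)"
    if "\<forall>i. r $ f i + (\<Sum>j\<in>UNIV. Q (f i) $ j * u $ j) = l + u $ i" for r u l
  proof -
    have shift: "(\<Sum>j\<in>UNIV. Q (f i) $ j * (u + t *\<^sub>R 1) $ j) = (\<Sum>j\<in>UNIV. Q (f i) $ j * u $ j) + t" for i t
      using Q[of "f i"] by (simp add: distrib_left sum.distrib flip: sum_distrib_right)
    have "L (u + (l - u $ k) *\<^sub>R 1) $ i = r $ f i" for i
      using that[rule_format, of i] unfolding L_def shift by simp
    then show ?thesis by (simp add: vec_eq_iff)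
  qed
  show ?thesis
  proof (cases "surj L")
    case True
    then have inj: "inj L" using lin linear_surjective_imp_injective by blast
    have "\<exists>t. v = u + t *\<^sub>R 1"
      if "\<forall>i. r $ f i + (\<Sum>j\<in>UNIV. Q (f i) $ j * u $ j) = l + u $ i"
        "\<forall>i. r $ f i + (\<Sum>j\<in>UNIV. Q (f i) $ j * v $ j) = m + v $ i" for r u v l m
    proof -
      have "u + (l - u $ k) *\<^sub>R 1 = v + (m - v $ k) *\<^sub>R 1"
        using L[OF that(1)] L[OF that(2)] inj by (metis injD)
      then have "v = u + ((l - u $ k) - (m - v $ k)) *\<^sub>R 1"
        by (simp add: algebra_simps)
      then show ?thesis by blast
    qed
    \<comment> \<open>Uniqueness holds here for every \<open>r\<close>, so any nonzero normal will
      do.\<close>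
    moreover have "(1 :: real ^ 'q) \<noteq> 0" by simp
    ultimately show ?thesis by blast
  next
    case False
    then have "span (range L) \<noteq> UNIV"
      using lin by (metis linear_subspace_image span_eq_iff subspace_UNIV)
    then obtain a where a: "a \<noteq> 0" "span (range L) \<subseteq> {x. a \<bullet> x = 0}"
      using span_not_univ_subset_hyperplane by blast
    \<comment> \<open>The normal \<open>a\<close> carried over to payment space along
      \<open>f\<close>; injectivity of \<open>f\<close> prevents cancellation, so \<open>c\<close>
      is nonzero.\<close>
    define c :: "real ^ 'q" where "c = (\<Sum>i\<in>UNIV. a $ i *\<^sub>R axis (f i) 1)"
    have "c \<bullet> r = a \<bullet> (\<chi> i. r $ f i)" for r
      by (simp add: c_def inner_sum_left inner_axis') (simp add: inner_vec_def)
    \<comment> \<open>A solvable system puts \<open>r\<close> in the hyperplane, which makes the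
      claim vacuous off it.\<close>
    then have "c \<bullet> r = 0" if "\<forall>i. r $ f i + (\<Sum>j\<in>UNIV. Q (f i) $ j * u $ j) = l + u $ i" for r u l
      using a(2) L[OF that] span_base by (metis (mono_tags, lifting) mem_Collect_eq rangeI subset_iff)
    moreover have "c \<noteq> 0"
    proof -
      obtain i where i: "a $ i \<noteq> 0" using a(1) by (auto simp: vec_eq_iff)
      have "c $ f i = (\<Sum>j\<in>UNIV. if j = i then a $ j else 0)"
        unfolding c_def sum_component
        by (rule sum.cong) (use assms(1) in \<open>auto simp: axis_def inj_eq\<close>)
      then show ?thesis using i by auto
    qed
    ultimately show ?thesis by metis
  qed
qed

section \<open>Shapley operators and the fan of their policies\<close>

text \<open>Nonnegative weights preserve the inequality and total weight 1 passes the constant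
  through; maxima and minima preserve both.\<close>

lemma topical_shapley:
  fixes A :: "'n::finite \<Rightarrow> 'a set" and idx :: "'n \<times> 'a \<times> 'b \<Rightarrow> 'q::finite"
  assumes A: "\<And>i. finite (A i) \<and> A i \<noteq> {}"
    and B: "\<And>i a. a \<in> A i \<Longrightarrow> finite (B i a) \<and> B i a \<noteq> {}"
    and P: "\<And>i a b. a \<in> A i \<Longrightarrow> b \<in> B i a \<Longrightarrow> probability_vector (P i a b)"
  shows "topical (shapley A B P idx r)"
  unfolding topical_def
proof (intro allI impI)
  fix x y :: "real ^ 'n" and c i
  assume le: "\<forall>i. x $ i \<le> y $ i + c"
  let ?g = "\<lambda>x a b. r $ idx (i, a, b) + (\<Sum>j\<in>UNIV. P i a b $ j * x $ j)"
  let ?G = "\<lambda>x a. MAX b\<in>B i a. ?g x a b"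
  have g: "?g x a b \<le> ?g y a b + c" if "a \<in> A i" "b \<in> B i a" for a b
  proof -
    have Pab: "\<And>j. 0 \<le> P i a b $ j" "(\<Sum>j\<in>UNIV. P i a b $ j) = 1"
      using P[OF that] by (auto simp: probability_vector_def)
    have "(\<Sum>j\<in>UNIV. P i a b $ j * x $ j) \<le> (\<Sum>j\<in>UNIV. P i a b $ j * (y $ j + c))"
      using le Pab by (intro sum_mono mult_left_mono) auto
    also have "\<dots> = (\<Sum>j\<in>UNIV. P i a b $ j * y $ j) + c"
      using Pab(2) by (simp add: distrib_left sum.distrib flip: sum_distrib_right)
    finally show ?thesis by simp
  qed
  have G: "?G x a \<le> ?G y a + c" if a: "a \<in> A i" for a
  proof -
    have "?g x a b \<le> ?G y a + c" if "b \<in> B i a" for b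
    proof -
      have "?g y a b \<le> ?G y a" using B[OF a] that by (intro Max_ge) auto
      then show ?thesis using g[OF a that] by linarith
    qed
    then show ?thesis using B[OF a] by simp
  qed
  have "(MIN a\<in>A i. ?G y a) \<in> ?G y ` A i"
    using A by (intro Min_in) auto
  then obtain a where a: "a \<in> A i" "(MIN a\<in>A i. ?G y a) = ?G y a" by blast
  have "(MIN a\<in>A i. ?G x a) \<le> ?G x a" using A a(1) by (intro Min_le) auto
  also have "\<dots> \<le> (MIN a\<in>A i. ?G y a) + c" using G[OF a(1)] a(2) by simp
  finally show "shapley A B P idx r x $ i \<le> shapley A B P idx r y $ i + c"
    by (simp add: shapley_def)
qed

lemma shapley_attained:
  fixes A :: "'n::finite \<Rightarrow> 'a set" and idx :: "'n \<times> 'a \<times> 'b \<Rightarrow> 'q::finite"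
  assumes A: "\<And>i. finite (A i) \<and> A i \<noteq> {}"
    and B: "\<And>i a. a \<in> A i \<Longrightarrow> finite (B i a) \<and> B i a \<noteq> {}"
  shows "\<exists>a\<in>A i. \<exists>b\<in>B i a. shapley A B P idx r x $ i =
    r $ idx (i, a, b) + (\<Sum>j\<in>UNIV. P i a b $ j * x $ j)"
proof -
  let ?g = "\<lambda>a b. r $ idx (i, a, b) + (\<Sum>j\<in>UNIV. P i a b $ j * x $ j)"
  have "(MIN a\<in>A i. MAX b\<in>B i a. ?g a b) \<in> (\<lambda>a. MAX b\<in>B i a. ?g a b) ` A i"
    using A by (intro Min_in) auto
  then obtain a where a: "a \<in> A i" "(MIN a\<in>A i. MAX b\<in>B i a. ?g a b) = (MAX b\<in>B i a. ?g a b)" by blast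
  have "(MAX b\<in>B i a. ?g a b) \<in> ?g a ` B i a"
    using B[OF a(1)] by (intro Max_in) auto
  with a show ?thesis by (auto simp: shapley_def)
qed

theorem theorem10:
  fixes A :: "'n::finite \<Rightarrow> 'a set"
    and B :: "'n \<Rightarrow> 'a \<Rightarrow> 'b set"
    and P :: "'n \<Rightarrow> 'a \<Rightarrow> 'b \<Rightarrow> real ^ 'n"
    and idx :: "'n \<times> 'a \<times> 'b \<Rightarrow> 'q::finite"
  assumes "\<And>i. finite (A i) \<and> A i \<noteq> {}"
    and "\<And>i a. a \<in> A i \<Longrightarrow> finite (B i a) \<and> B i a \<noteq> {}"
    and "\<And>i a b. a \<in> A i \<Longrightarrow> b \<in> B i a \<Longrightarrow> probability_vector (P i a b)"
    and "bij_betw idx (action_triples A B) UNIV"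
    and "\<And>r :: real ^ 'q. \<exists>l. has_eigenvalue (shapley A B P idx r) l"
  shows "\<exists>K :: (real ^ 'q) set set.
    polyhedral_fan K \<and> \<Union>K = UNIV \<and>
    (\<forall>C\<in>K. full_dimensional C \<longrightarrow>
      (\<forall>r\<in>interior C. unique_eigenvector (shapley A B P idx r)))"
proof -
  define triple where "triple = inv_into (action_triples A B) idx"
  \<comment> \<open>With transition rows indexed by payment coordinates, a choice of one triple per
    state becomes a map \<open>f\<close> from states to coordinates.\<close>
  define Q where "Q q = (case triple q of (i, a, b) \<Rightarrow> P i a b)" for q
  have triple: "triple (idx (i, a, b)) = (i, a, b)" if "a \<in> A i" "b \<in> B i a" for i a b
    unfolding triple_def using assms(4) that
    by (intro inv_into_f_f) (auto simp: bij_betw_def action_triples_def)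
  have Q: "(\<Sum>j\<in>UNIV. Q q $ j) = 1" for q
  proof -
    have "triple q \<in> action_triples A B"
      unfolding triple_def using assms(4) by (intro inv_into_into) (simp add: bij_betw_def)
    then obtain i a b where "triple q = (i, a, b)" "a \<in> A i" "b \<in> B i a"
      by (auto simp: action_triples_def)
    then show ?thesis
      using assms(3)[of a i b] by (simp add: Q_def probability_vector_def)
  qed
  have attained: "\<exists>a\<in>A i. \<exists>b\<in>B i a. shapley A B P idx r x $ i =
      r $ idx (i, a, b) + (\<Sum>j\<in>UNIV. P i a b $ j * x $ j)" for r x i
    by (rule shapley_attained) (use assms(1,2) in auto)
  have topical: "topical (shapley A B P idx r)" for r
    by (rule topical_shapley) (use assms(1-3) in auto)
  define separates where "separates f c \<longleftrightarrow> c \<noteq> 0 \<and> (\<forall>r u v l m. c \<bullet> r \<noteq> 0 \<longrightarrow>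
    (\<forall>i. r $ f i + (\<Sum>j\<in>UNIV. Q (f i) $ j * u $ j) = l + u $ i) \<longrightarrow>
    (\<forall>i. r $ f i + (\<Sum>j\<in>UNIV. Q (f i) $ j * v $ j) = m + v $ i) \<longrightarrow> (\<exists>t. v = u + t *\<^sub>R 1))"
    for f :: "'n \<Rightarrow> 'q" and c :: "real ^ 'q"
  have "\<exists>c. separates f c" if "inj f" for f
    unfolding separates_def by (rule policy_bias_generically_unique[OF that Q])
  then obtain c where c: "\<And>f. inj f \<Longrightarrow> separates f (c f)"
    by metis
  \<comment> \<open>One normal per injective \<open>f\<close>; there are finitely many such maps
    between finite types.\<close>
  define H where "H = c ` {f. inj f}"
  have fin: "finite H" by (simp add: H_def)
  have "unique_eigenvector (shapley A B P idx r)" if r: "r \<in> interior (sign_cone H x)" for r x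
  proof -
    let ?T = "shapley A B P idx r"
    have "\<exists>f. inj f \<and> (\<forall>i. ?T u $ i = r $ f i + (\<Sum>j\<in>UNIV. Q (f i) $ j * u $ j))" for u
    proof -
      \<comment> \<open>Recording the state of the chosen triple makes the resulting
        \<open>f\<close> injective.\<close>
      have "\<exists>q. fst (triple q) = i \<and> ?T u $ i = r $ q + (\<Sum>j\<in>UNIV. Q q $ j * u $ j)" for i
      proof -
        obtain a b where "a \<in> A i" "b \<in> B i a"
          "?T u $ i = r $ idx (i, a, b) + (\<Sum>j\<in>UNIV. P i a b $ j * u $ j)"
          using attained[of i r u] by blast
        then show ?thesis
          by (intro exI[of _ "idx (i, a, b)"]) (simp add: Q_def triple)
      qed
      then have "\<exists>f. \<forall>i. fst (triple (f i)) = i \<and> ?T u $ i = r $ f i + (\<Sum>j\<in>UNIV. Q (f i) $ j * u $ j)"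
        by (intro choice) blast
      then obtain f where f: "\<And>i. fst (triple (f i)) = i"
          "\<And>i. ?T u $ i = r $ f i + (\<Sum>j\<in>UNIV. Q (f i) $ j * u $ j)"
        by blast
      have "inj f" by (rule injI) (metis f(1))
      with f(2) show ?thesis by blast
    qed
    \<comment> \<open>The label \<open>p u\<close> is a choice of triples attaining the operator at
      \<open>u\<close>.\<close>
    then have "\<exists>p. \<forall>u. inj (p u) \<and> (\<forall>i. ?T u $ i = r $ p u i + (\<Sum>j\<in>UNIV. Q (p u i) $ j * u $ j))"
      by (intro choice) blast
    then obtain p where p: "\<And>u. inj (p u)"
      "\<And>u i. ?T u $ i = r $ p u i + (\<Sum>j\<in>UNIV. Q (p u i) $ j * u $ j)"
      by blast
    have bias: "\<exists>l. \<forall>i. r $ p u i + (\<Sum>j\<in>UNIV. Q (p u i) $ j * u $ j) = l + u $ i"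
      if u: "u \<in> eigenvectors ?T" for u
    proof -
      obtain l where "?T u = l *\<^sub>R 1 + u"
        using u unfolding eigenvectors_def by blast
      then have "\<forall>i. r $ p u i + (\<Sum>j\<in>UNIV. Q (p u i) $ j * u $ j) = l + u $ i"
        unfolding p(2)[of u, symmetric] by simp
      then show ?thesis by blast
    qed
    obtain l where "has_eigenvalue ?T l" using assms(5) by blast
    with topical show ?thesis
    proof (rule unique_eigenvector_if_finitely_many)
      fix u v assume u: "u \<in> eigenvectors ?T" and v: "v \<in> eigenvectors ?T" and eq: "p u = p v"
      \<comment> \<open>As \<open>r\<close> avoids the hyperplane of \<open>p u\<close>,
        eigenvectors with this common label solve one linear system and differ by a
        constant.\<close>
      have "c (p u) \<bullet> r \<noteq> 0"
        using r by (rule inner_neq_0_interior_sign_cone) (use c p(1) in \<open>auto simp: H_def separates_def\<close>)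
      then show "\<exists>t. v = u + t *\<^sub>R 1"
        using bias[OF u] bias[OF v] c[OF p(1)] unfolding eq separates_def by blast
    qed
  qed
  moreover have "\<Union>(range (sign_cone H)) = UNIV"
    using mem_sign_cone_self by blast
  ultimately show ?thesis
    using polyhedral_fan_sign_cones[OF fin] by (intro exI[of _ "range (sign_cone H)"]) blast
qed

end
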